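(* Let $f:\mathbb{R}^m\to\mathbb{R}$ be a $C^1$ function. Let $\{z_n\}_{n\ge0}$ be an (infinite) sequence constructed by either the Backtracking MMT update rule or the Backtracking NAG update rule. Then: 1) Either $\lim_{n\to\infty}\|z_n\|=\infty$ or $\lim_{n\to\infty}\|z_{n+1}-z_n\|=0$. 2) Assume that $f$ has at most countably many critical points. Then either $\lim_{n\to\infty}\|z_n\|=\infty$ or $\{z_n\}$ converges to a critical point of $f$. 3) More generally, assume that all connected components of the set of critical points of $f$ are compact. Then either $\lim_{n\to\infty}\|z_n\|=\infty$ or $\{z_n\}$ is bounded. Moreover, in the latter case the set of cluster points of $\{z_n\}$ is connected.
   Context: $\langle\cdot,\cdot\rangle$ and $\|\cdot\|$ are the standard inner product and Euclidean norm on $\mathbb{R}^m$. A critical point of $f$ is a point where $\nabla f$ vanishes. A cluster point of a sequence is a limit of one of its convergent subsequences (in $\mathbb{R}^m$). Parameters (fixed): $0<A_1<1<A_2$; $\delta_0,\gamma_0>0$; $0<\mu\le1$; $0<\alpha,\beta<1$; and initial points $z_0,v_{-1}\in\mathbb{R}^m$. Backtracking MMT. Given $z_n$ and $v_{n-1}$ ($n\ge0$), the next vectors $v_n$ and $z_{n+1}$ are produced in two stages. Stage 1: start with $\gamma'=\gamma_0$ and put $w=\gamma'v_{n-1}+\delta_0\nabla f(z_n)$. While the condition $$A_1\|\nabla f(z_n)\|\le\|w\|\le A_2\|\nabla f(z_n)\|\quad\text{and}\quad\langle\nabla f(z_n),w\rangle\ge\mu\|\nabla f(z_n)\|\,\|w\|$$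 is not satisfied, replace $\gamma'$ by $\beta\gamma'$ and update $w$ accordingly. Let $\gamma_n'$ and $w_n$ be the values of $\gamma'$ and $w$ when the condition is first satisfied. Stage 2: start with $\sigma=1$. While the condition $$f(z_n-\sigma w_n)-f(z_n)\le-\alpha\sigma\langle\nabla f(z_n),w_n\rangle$$ is not satisfied, replace $\sigma$ by $\beta\sigma$. Let $\sigma_n$ be the value of $\sigma$ when the condition is first satisfied. Then set $v_n=\sigma_nw_n$ and $z_{n+1}=z_n-v_n$. (Thus $v_n=\gamma_nv_{n-1}+\delta_n\nabla f(z_n)$ with multipliers $\gamma_n=\sigma_n\gamma_n'$ and $\delta_n=\sigma_n\delta_0$ of step $n$.) Backtracking NAG. The same procedure, except that in Stage 1 one uses $w=\gamma'v_{n-1}+\delta_0\nabla f(z_n-\gamma'v_{n-1})$ in place of $w=\gamma'v_{n-1}+\delta_0\nabla f(z_n)$. A sequence constructed by one of these rules is one for which both while-loops terminate at every step $n\ge0$. *)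

theory Defs
  imports "HOL-Analysis.Analysis" "HOL-Library.While_Combinator"
begin

text \<open>The gradient is only meaningful where the function is differentiable.\<close>

definition gradient :: "('a::real_inner \<Rightarrow> real) \<Rightarrow> 'a \<Rightarrow> 'a" where
  "gradient f x = (THE D. GDERIV f x :> D)"

lemma gradient_eqI:
  assumes "GDERIV f x :> D"
  shows "gradient f x = D"
  unfolding gradient_def
proof (rule the_equality)
  fix D' assume "GDERIV f x :> D'"
  with assms have "(\<lambda>h. h \<bullet> D') = (\<lambda>h. h \<bullet> D)"
    unfolding gderiv_def by (rule has_derivative_unique[rotated])
  then show "D' = D"
    by (metis vector_eq_ldot)
qed (rule assms)

lemma gderiv_gradient:
  fixes f :: "'a::euclidean_space \<Rightarrow> real"
  assumes "f differentiable (at x)"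
  shows "GDERIV f x :> gradient f x"
proof -
  obtain f' where f': "(f has_derivative f') (at x)"
    using assms by (auto simp: differentiable_def)
  then have lin: "linear f'"
    by (rule has_derivative_linear)
  have "f' = (\<lambda>h. h \<bullet> adjoint f' 1)"
    using adjoint_works[OF lin, of _ 1] by (simp add: fun_eq_iff)
  with f' have "GDERIV f x :> adjoint f' 1"
    by (simp add: gderiv_def)
  then show ?thesis
    using gradient_eqI by metis
qed

definition C1_function :: "('a::real_inner \<Rightarrow> real) \<Rightarrow> bool" where
  "C1_function f \<longleftrightarrow> (\<forall>x. f differentiable (at x)) \<and> continuous_on UNIV (gradient f)"

definition critical_points :: "('a::real_inner \<Rightarrow> real) \<Rightarrow> 'a set" where
  "critical_points f = {x. gradient f x = 0}"

definition cluster_points :: "(nat \<Rightarrow> 'a::topological_space) \<Rightarrow> 'a set" where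
  "cluster_points z = {l. \<exists>r. strict_mono r \<and> (z \<circ> r) \<longlonglongrightarrow> l}"

definition mmt_direction ::
    "('a::real_inner \<Rightarrow> real) \<Rightarrow> real \<Rightarrow> 'a \<Rightarrow> 'a \<Rightarrow> real \<Rightarrow> 'a" where
  "mmt_direction f \<delta>\<^sub>0 z v \<gamma> = \<gamma> *\<^sub>R v + \<delta>\<^sub>0 *\<^sub>R gradient f z"

definition nag_direction ::
    "('a::real_inner \<Rightarrow> real) \<Rightarrow> real \<Rightarrow> 'a \<Rightarrow> 'a \<Rightarrow> real \<Rightarrow> 'a" where
  "nag_direction f \<delta>\<^sub>0 z v \<gamma> = \<gamma> *\<^sub>R v + \<delta>\<^sub>0 *\<^sub>R gradient f (z - \<gamma> *\<^sub>R v)"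

definition direction_condition :: "real \<Rightarrow> real \<Rightarrow> real \<Rightarrow> 'a::real_inner \<Rightarrow> 'a \<Rightarrow> bool" where
  "direction_condition A\<^sub>1 A\<^sub>2 \<mu> g w \<longleftrightarrow>
     A\<^sub>1 * norm g \<le> norm w \<and> norm w \<le> A\<^sub>2 * norm g \<and> g \<bullet> w \<ge> \<mu> * norm g * norm w"

definition armijo_condition ::
    "('a::real_inner \<Rightarrow> real) \<Rightarrow> real \<Rightarrow> 'a \<Rightarrow> 'a \<Rightarrow> real \<Rightarrow> bool" where
  "armijo_condition f \<alpha> z w \<sigma> \<longleftrightarrow>
     f (z - \<sigma> *\<^sub>R w) - f z \<le> - \<alpha> * \<sigma> * (gradient f z \<bullet> w)"

text \<open>
  The two while-loops are rendered with \<^const>\<open>while_option\<close>, whose value \<^term>\<open>Some s\<close>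
  means that the loop terminates in state \<open>s\<close>. The argument \<open>dir z v\<close> maps the current
  value of \<open>\<gamma>'\<close> to \<open>w\<close>.
\<close>

definition backtracking_step ::
    "('a::real_inner \<Rightarrow> 'a \<Rightarrow> real \<Rightarrow> 'a) \<Rightarrow> ('a \<Rightarrow> real) \<Rightarrow> real \<Rightarrow> real \<Rightarrow> real \<Rightarrow> real \<Rightarrow>
     real \<Rightarrow> real \<Rightarrow> 'a \<Rightarrow> 'a \<Rightarrow> 'a \<Rightarrow> 'a \<Rightarrow> bool" where
  "backtracking_step dir f A\<^sub>1 A\<^sub>2 \<gamma>\<^sub>0 \<mu> \<alpha> \<beta> z v z' v' \<longleftrightarrow>
     (\<exists>\<gamma> \<sigma> w.
        while_option (\<lambda>\<gamma>'. \<not> direction_condition A\<^sub>1 A\<^sub>2 \<mu> (gradient f z) (dir z v \<gamma>'))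
          (\<lambda>\<gamma>'. \<beta> * \<gamma>') \<gamma>\<^sub>0 = Some \<gamma> \<and>
        w = dir z v \<gamma> \<and>
        while_option (\<lambda>\<sigma>'. \<not> armijo_condition f \<alpha> z w \<sigma>') (\<lambda>\<sigma>'. \<beta> * \<sigma>') 1 = Some \<sigma> \<and>
        v' = \<sigma> *\<^sub>R w \<and>
        z' = z - v')"

text \<open>
  The momentum sequence is shifted by one index: \<open>v n\<close> stands for $v_{n-1}$, so that
  \<open>v 0 = v_init\<close> is the initial vector $v_{-1}$.
\<close>

definition backtracking_sequence ::
    "('a::real_inner \<Rightarrow> 'a \<Rightarrow> real \<Rightarrow> 'a) \<Rightarrow> ('a \<Rightarrow> real) \<Rightarrow> real \<Rightarrow> real \<Rightarrow> real \<Rightarrow> real \<Rightarrow>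
     real \<Rightarrow> real \<Rightarrow> 'a \<Rightarrow> 'a \<Rightarrow> (nat \<Rightarrow> 'a) \<Rightarrow> bool" where
  "backtracking_sequence dir f A\<^sub>1 A\<^sub>2 \<gamma>\<^sub>0 \<mu> \<alpha> \<beta> z_init v_init z \<longleftrightarrow>
     (\<exists>v. z 0 = z_init \<and> v 0 = v_init \<and>
        (\<forall>n. backtracking_step dir f A\<^sub>1 A\<^sub>2 \<gamma>\<^sub>0 \<mu> \<alpha> \<beta> (z n) (v n) (z (Suc n)) (v (Suc n))))"

definition backtracking_MMT ::
    "('a::real_inner \<Rightarrow> real) \<Rightarrow> real \<Rightarrow> real \<Rightarrow> real \<Rightarrow> real \<Rightarrow> real \<Rightarrow> real \<Rightarrow> real \<Rightarrow>
     'a \<Rightarrow> 'a \<Rightarrow> (nat \<Rightarrow> 'a) \<Rightarrow> bool" where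
  "backtracking_MMT f A\<^sub>1 A\<^sub>2 \<delta>\<^sub>0 \<gamma>\<^sub>0 \<mu> \<alpha> \<beta> =
     backtracking_sequence (mmt_direction f \<delta>\<^sub>0) f A\<^sub>1 A\<^sub>2 \<gamma>\<^sub>0 \<mu> \<alpha> \<beta>"

definition backtracking_NAG ::
    "('a::real_inner \<Rightarrow> real) \<Rightarrow> real \<Rightarrow> real \<Rightarrow> real \<Rightarrow> real \<Rightarrow> real \<Rightarrow> real \<Rightarrow> real \<Rightarrow>
     'a \<Rightarrow> 'a \<Rightarrow> (nat \<Rightarrow> 'a) \<Rightarrow> bool" where
  "backtracking_NAG f A\<^sub>1 A\<^sub>2 \<delta>\<^sub>0 \<gamma>\<^sub>0 \<mu> \<alpha> \<beta> =
     backtracking_sequence (nag_direction f \<delta>\<^sub>0) f A\<^sub>1 A\<^sub>2 \<gamma>\<^sub>0 \<mu> \<alpha> \<beta>"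

end

theory Submission
  imports Defs
begin

text \<open>
  The Armijo condition together with the direction condition bounds the squared step length by a
  multiple of the decrease of \<open>f\<close>. If the sequence has a cluster point, the values of \<open>f\<close> are
  bounded below, so the steps tend to 0. A step is short only if the gradient is small or varies by
  a fixed proportion near \<open>z\<^sub>n\<close>, so by continuity of the gradient every cluster point is critical.
  A sequence with vanishing steps that enters and leaves a bounded open set infinitely often has a
  cluster point on its frontier. Surrounding a compact component of the critical set by
  a bounded open set whose frontier avoids the critical set, one sees that the sequence is bounded;
  separating two parts of the cluster set, one sees that the latter is connected.
\<close>

section \<open>Cluster points of sequences with vanishing steps\<close>

text \<open>This replaces the choice of a subsequence by a condition on neighbourhoods. For the
  converse, indices are chosen recursively, each beyond the last, with distance below
  \<open>1 / (k + 1)\<close>.\<close>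

lemma cluster_points_iff_frequently:
  fixes z :: "nat \<Rightarrow> 'a::metric_space"
  shows "l \<in> cluster_points z \<longleftrightarrow> (\<forall>e>0. \<exists>\<^sub>F n in sequentially. dist (z n) l < e)"
proof
  assume "l \<in> cluster_points z"
  then obtain r where r: "strict_mono r" "(z \<circ> r) \<longlonglongrightarrow> l"
    by (auto simp: cluster_points_def)
  show "\<forall>e>0. \<exists>\<^sub>F n in sequentially. dist (z n) l < e"
  proof (intro allI impI, unfold frequently_sequentially, intro allI)
    fix e :: real and N
    assume "e > 0"
    then obtain M where "\<And>k. k \<ge> M \<Longrightarrow> dist (z (r k)) l < e"
      using r(2) by (auto simp: lim_sequentially)
    moreover have "N \<le> r (max M N)"
      using seq_suble[OF r(1), of "max M N"] by linarith
    ultimately show "\<exists>n\<ge>N. dist (z n) l < e"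
      by (meson max.cobounded1)
  qed
next
  assume *: "\<forall>e>0. \<exists>\<^sub>F n in sequentially. dist (z n) l < e"
  have "\<exists>n\<ge>N. dist (z n) l < inverse (real (Suc k))" for N k
    using * by (simp add: frequently_sequentially)
  then have "\<exists>r. \<forall>k. dist (z (r k)) l < inverse (real (Suc k)) \<and> r k < r (Suc k)"
    by (intro dependent_nat_choice) (meson Suc_le_eq)+
  then obtain r where r: "\<And>k. dist (z (r k)) l < inverse (real (Suc k))" "\<And>k. r k < r (Suc k)"
    by blast
  have "(z \<circ> r) \<longlonglongrightarrow> l"
  proof (rule tendsto_dist_iff[THEN iffD2], rule tendsto_sandwich[OF _ _ tendsto_const LIMSEQ_inverse_real_of_nat])
    show "\<forall>\<^sub>F k in sequentially. dist ((z \<circ> r) k) l \<le> inverse (real (Suc k))"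
      by (simp only: o_apply r(1)[THEN less_imp_le] eventually_True)
  qed simp
  moreover have "strict_mono r"
    using r(2) by (simp add: strict_mono_Suc_iff)
  ultimately show "l \<in> cluster_points z"
    unfolding cluster_points_def by blast
qed

lemma frequently_in_open_if_cluster_point:
  fixes z :: "nat \<Rightarrow> 'a::metric_space"
  assumes "l \<in> cluster_points z" "open U" "l \<in> U"
  shows "\<exists>\<^sub>F n in sequentially. z n \<in> U"
proof -
  obtain e where "e > 0" "ball l e \<subseteq> U"
    using assms(2,3) by (auto simp: open_contains_ball)
  then have "\<exists>\<^sub>F n in sequentially. dist (z n) l < e"
    using assms(1) by (simp add: cluster_points_iff_frequently)
  then show ?thesis
    by (rule frequently_elim1) (use \<open>ball l e \<subseteq> U\<close> in \<open>auto simp: dist_commute\<close>)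
qed

lemma closed_cluster_points:
  fixes z :: "nat \<Rightarrow> 'a::metric_space"
  shows "closed (cluster_points z)"
proof -
  have "l \<in> cluster_points z" if l: "l \<in> closure (cluster_points z)" for l
    unfolding cluster_points_iff_frequently
  proof (intro allI impI)
    fix e :: real
    assume "e > 0"
    with l obtain y where "y \<in> cluster_points z" "dist y l < e"
      by (auto simp: closure_approachable)
    then show "\<exists>\<^sub>F n in sequentially. dist (z n) l < e"
      using frequently_in_open_if_cluster_point[of y z "ball l e"] by (simp add: dist_commute)
  qed
  then show ?thesis
    by (simp add: closure_subset_eq[symmetric] subsetI)
qed

text \<open>Bolzano-Weierstrass along the infinitely many indices where \<open>P\<close> holds.
  Keeping \<open>P\<close> on the subsequence allows it to record more than membership in
  \<open>S\<close>, such as leaving a set at the next step.\<close>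

lemma frequently_bounded_imp_convergent_subseq:
  fixes z :: "nat \<Rightarrow> 'a::heine_borel"
  assumes freq: "\<exists>\<^sub>F n in sequentially. P n" and "bounded S" and "\<And>n. P n \<Longrightarrow> z n \<in> S"
  obtains r l where "strict_mono r" "\<And>k. P (r k)" "(z \<circ> r) \<longlonglongrightarrow> l"
proof -
  have "infinite {n. P n}"
    using freq by (simp add: cofinite_eq_sequentially[symmetric] frequently_cofinite)
  then obtain s :: "nat \<Rightarrow> nat" where s: "strict_mono s" "\<And>k. P (s k)"
    using infinite_enumerate[of "{n. P n}"] by auto
  have "seq_compact (closure S)"
    using \<open>bounded S\<close> by (simp add: compact_closure compact_imp_seq_compact)
  moreover have "\<forall>n. (z \<circ> s) n \<in> closure S"
    using s(2) assms(3) closure_subset by auto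
  ultimately obtain l t where "strict_mono t" "((z \<circ> s) \<circ> t) \<longlonglongrightarrow> l"
    by (rule seq_compactE)
  with s show ?thesis
    by (intro that[of "s \<circ> t"]) (auto simp: strict_mono_o o_assoc)
qed

text \<open>If the norms do not diverge, some ball around 0 contains infinitely many terms.\<close>

lemma cluster_point_if_not_norm_at_top:
  fixes z :: "nat \<Rightarrow> 'a::{heine_borel, real_normed_vector}"
  assumes "\<not> filterlim (\<lambda>n. norm (z n)) at_top sequentially"
  obtains l where "l \<in> cluster_points z"
proof -
  obtain B where "\<exists>\<^sub>F n in sequentially. norm (z n) < B"
    using assms by (auto simp: filterlim_at_top not_eventually not_le)
  then obtain r l where "strict_mono r" "(z \<circ> r) \<longlonglongrightarrow> l"
    by (rule frequently_bounded_imp_convergent_subseq[where S = "ball 0 B"]) auto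
  then show ?thesis
    using that by (auto simp: cluster_points_def)
qed

section \<open>Crossing the frontier of an open set\<close>

lemma frequently_leaves:
  fixes P :: "nat \<Rightarrow> bool"
  assumes "\<exists>\<^sub>F n in sequentially. P n" "\<exists>\<^sub>F n in sequentially. \<not> P n"
  shows "\<exists>\<^sub>F n in sequentially. P n \<and> \<not> P (Suc n)"
proof (rule ccontr)
  assume "\<not> ?thesis"
  then obtain N where N: "\<And>n. n \<ge> N \<Longrightarrow> P n \<Longrightarrow> P (Suc n)"
    by (auto simp: not_frequently eventually_sequentially)
  obtain M where M: "M \<ge> N" "P M"
    using assms(1) by (auto simp: frequently_sequentially)
  have "P n" if "n \<ge> M" for n
    using that by (induction rule: dec_induct) (use M N in auto)
  with assms(2) show False
    by (auto simp: frequently_sequentially)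
qed

text \<open>At the exit indices a term in \<open>U\<close> is followed by a term outside
  \<open>U\<close>. Since the steps vanish, both have the same limit along a subsequence, which lies
  in both closures. Bounding only \<open>U \<inter> range z\<close> covers a bounded
  \<open>U\<close> as well as a bounded sequence.\<close>

lemma crossing_imp_cluster_point_on_frontier:
  fixes z :: "nat \<Rightarrow> 'a::{heine_borel, real_normed_vector}"
  assumes steps: "(\<lambda>n. norm (z (Suc n) - z n)) \<longlonglongrightarrow> 0"
    and bdd: "bounded (U \<inter> range z)"
    and inside: "\<exists>\<^sub>F n in sequentially. z n \<in> U"
    and outside: "\<exists>\<^sub>F n in sequentially. z n \<notin> U"
  obtains l where "l \<in> cluster_points z" "l \<in> frontier U"
proof -
  obtain r l where r: "strict_mono r" "\<And>k. z (r k) \<in> U \<and> z (Suc (r k)) \<notin> U" "(z \<circ> r) \<longlonglongrightarrow> l"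
    using frequently_leaves[OF inside outside]
    by (rule frequently_bounded_imp_convergent_subseq[OF _ bdd]) auto
  have "(\<lambda>k. z (Suc (r k)) - z (r k)) \<longlonglongrightarrow> 0"
    using LIMSEQ_subseq_LIMSEQ[OF steps r(1)] by (simp add: o_def tendsto_norm_zero_iff)
  from tendsto_add[OF this r(3)[unfolded o_def]] have "(\<lambda>k. z (Suc (r k))) \<longlonglongrightarrow> l"
    by simp
  then have "l \<in> closure (- U)"
    using r(2) by (force simp: closure_sequential)
  moreover have "l \<in> closure U"
    using r(2,3) by (force simp: closure_sequential o_def)
  ultimately have "l \<in> frontier U"
    by (simp add: frontier_closures)
  moreover have "l \<in> cluster_points z"
    using r(1,3) by (auto simp: cluster_points_def)
  ultimately show ?thesis
    by (rule that[rotated])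
qed

text \<open>An open set that misses \<open>U\<close> also misses its closure, and an open
  \<open>U\<close> contains none of its frontier points.\<close>

lemma frontier_disjoint_separated:
  assumes "open U" "open V" "U \<inter> V = {}"
  shows "frontier U \<inter> (U \<union> V) = {}"
proof -
  have "V \<inter> closure U = {}"
    using assms open_Int_closure_eq_empty[of V U] by blast
  with \<open>open U\<close> show ?thesis
    by (auto simp: frontier_def interior_open)
qed

text \<open>If the cluster set split into two closed parts, the sequence would visit disjoint open
  neighbourhoods of both infinitely often and so have a cluster point on a frontier, outside both
  neighbourhoods.\<close>

lemma connected_cluster_points:
  fixes z :: "nat \<Rightarrow> 'a::euclidean_space"
  assumes steps: "(\<lambda>n. norm (z (Suc n) - z n)) \<longlonglongrightarrow> 0" and bdd: "bounded (range z)"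
  shows "connected (cluster_points z)"
proof (rule ccontr)
  assume "\<not> ?thesis"
  then obtain A B where AB: "closed A" "closed B" "A \<noteq> {}" "B \<noteq> {}"
      "A \<union> B = cluster_points z" "A \<inter> B = {}"
    using connected_closed_set[OF closed_cluster_points] by metis
  obtain U V where UV: "open U" "open V" "A \<subseteq> U" "B \<subseteq> V" "U \<inter> V = {}"
    using separation_normal AB(1,2,6) by metis
  obtain a b where ab: "a \<in> A" "b \<in> B"
    using AB by blast
  have "\<exists>\<^sub>F n in sequentially. z n \<in> U"
    using ab AB UV frequently_in_open_if_cluster_point[of a z U] by blast
  moreover have "\<exists>\<^sub>F n in sequentially. z n \<in> V"
    using ab AB UV frequently_in_open_if_cluster_point[of b z V] by blast
  then have "\<exists>\<^sub>F n in sequentially. z n \<notin> U"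
    by (rule frequently_elim1) (use UV in auto)
  ultimately obtain l where "l \<in> cluster_points z" "l \<in> frontier U"
    by (rule crossing_imp_cluster_point_on_frontier[OF steps bounded_Int[OF disjI2[OF bdd]]])
  then show False
    using frontier_disjoint_separated[OF UV(1,2,5)] AB(5) UV(3,4) by blast
qed

text \<open>A component need not be relatively open in \<open>K\<close>, so it may fail to be
  separable from the rest of \<open>K\<close>; a larger compact \<open>L\<close>, open in
  \<open>K\<close>, can be separated. The frontier of the resulting \<open>U\<close> misses
  \<open>K\<close>, so the sequence crosses it only finitely often.\<close>

lemma bounded_if_cluster_points_in_compact_components:
  fixes z :: "nat \<Rightarrow> 'a::euclidean_space"
  assumes steps: "(\<lambda>n. norm (z (Suc n) - z n)) \<longlonglongrightarrow> 0"
    and K: "closed K" "\<And>C. C \<in> components K \<Longrightarrow> compact C"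
    and sub: "cluster_points z \<subseteq> K" and ne: "cluster_points z \<noteq> {}"
  shows "bounded (range z)"
proof -
  obtain x where x: "x \<in> cluster_points z" "x \<in> K"
    using sub ne by blast
  define C where "C = connected_component_set K x"
  have C: "C \<in> components K" "x \<in> C"
    using x(2) by (auto simp: C_def componentsI)
  \<comment> \<open>By Sura--Bura, the compact component \<open>C\<close> has a compact neighbourhood that is clopen in \<open>K\<close>.\<close>
  have "C = \<Inter> {L. C \<subseteq> L \<and> compact L \<and> openin (top_of_set K) L}"
    using C K by (intro Sura_Bura closed_imp_locally_compact) auto
  \<comment> \<open>The intersection of an empty family is \<open>UNIV\<close>, so this shows that
    some such \<open>L\<close> exists.\<close>
  moreover have "C \<noteq> UNIV"
    using K(2)[OF C(1)] not_compact_UNIV by auto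
  ultimately obtain L where L: "C \<subseteq> L" "compact L" "openin (top_of_set K) L"
    by force
  have "closed (K - L)"
    using K(1) L(3) by (metis closedin_closed_trans closedin_diff closedin_subtopology_refl topspace_euclidean subset_UNIV)
  then obtain U V where UV: "open U" "compact (closure U)" "open V" "L \<subseteq> U" "K - L \<subseteq> V" "U \<inter> V = {}"
    using separation_normal_compact[OF L(2)] by (metis Diff_disjoint)
  have bU: "bounded U"
    using UV(2) compact_imp_bounded bounded_subset closure_subset by blast
  have inside: "\<exists>\<^sub>F n in sequentially. z n \<in> U"
    using frequently_in_open_if_cluster_point x UV L C by blast
  have "\<not> (\<exists>\<^sub>F n in sequentially. z n \<notin> U)"
  proof
    assume "\<exists>\<^sub>F n in sequentially. z n \<notin> U"
    with inside obtain l where "l \<in> cluster_points z" "l \<in> frontier U"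
      by (rule crossing_imp_cluster_point_on_frontier[OF steps bounded_Int[OF disjI1[OF bU]]])
    then show False
      using frontier_disjoint_separated[OF UV(1,3,6)] sub UV(4,5) by blast
  qed
  then obtain N where "\<And>n. n \<ge> N \<Longrightarrow> z n \<in> U"
    by (auto simp: not_frequently eventually_sequentially)
  then have "z n \<in> z ` {..<N} \<union> U" for n
    by (cases "n < N") auto
  then have "range z \<subseteq> z ` {..<N} \<union> U"
    by blast
  then show ?thesis
    by (rule bounded_subset[rotated]) (auto simp: bU finite_imp_bounded)
qed

text \<open>Infinitely many terms at distance at least \<open>e\<close> from \<open>x\<close> would,
  by boundedness, have a cluster point other than \<open>x\<close>.\<close>

lemma tendsto_unique_cluster_point:
  fixes z :: "nat \<Rightarrow> 'a::heine_borel"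
  assumes "bounded (range z)" and uniq: "cluster_points z \<subseteq> {x}"
  shows "z \<longlonglongrightarrow> x"
proof (rule ccontr)
  assume "\<not> z \<longlonglongrightarrow> x"
  then obtain e where "e > 0" and freq: "\<exists>\<^sub>F n in sequentially. \<not> dist (z n) x < e"
    by (auto simp: tendsto_iff not_eventually)
  from freq obtain r l where r: "strict_mono r" "\<And>k. \<not> dist (z (r k)) x < e" "(z \<circ> r) \<longlonglongrightarrow> l"
    by (rule frequently_bounded_imp_convergent_subseq[where z = z, OF _ assms(1)]) auto
  then have "(z \<circ> r) \<longlonglongrightarrow> x"
    using uniq by (auto simp: cluster_points_def)
  with \<open>e > 0\<close> obtain k where "dist (z (r k)) x < e"
    by (auto simp: lim_sequentially)
  with r(2) show False by blast
qed

section \<open>The descent estimate\<close>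

lemma gradient_mean_value:
  fixes f :: "'a::euclidean_space \<Rightarrow> real"
  assumes "\<And>x. f differentiable (at x)"
  obtains t where "0 \<le> t" "t \<le> 1" "f (x + h) - f x = h \<bullet> gradient f (x + t *\<^sub>R h)"
proof -
  have "((\<lambda>t. f (x + t *\<^sub>R h)) has_derivative (\<lambda>s. (s *\<^sub>R h) \<bullet> gradient f (x + t *\<^sub>R h)))
      (at t within {0..1})" for t
  proof -
    have "(f has_derivative (\<lambda>k. k \<bullet> gradient f (x + t *\<^sub>R h))) (at (x + t *\<^sub>R h))"
      using gderiv_gradient[OF assms] by (simp add: gderiv_def)
    moreover have "((\<lambda>t. x + t *\<^sub>R h) has_derivative (\<lambda>s. s *\<^sub>R h)) (at t within {0..1})"
      by (auto intro!: derivative_eq_intros)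
    ultimately show ?thesis
      using has_derivative_compose by blast
  qed
  from mvt_very_simple[OF zero_le_one this] show ?thesis
    using that by auto
qed

text \<open>All that is kept of the two loops: their exit conditions and, for the second, an
  invariant on the last rejected value. The map \<open>dir\<close> is arbitrary, which treats MMT
  and NAG at once.\<close>

lemma backtracking_stepE:
  assumes "backtracking_step dir f A\<^sub>1 A\<^sub>2 \<gamma>\<^sub>0 \<mu> \<alpha> \<beta> z v z' v'" and "0 < \<beta>" "\<beta> < 1"
  obtains \<sigma> w where "direction_condition A\<^sub>1 A\<^sub>2 \<mu> (gradient f z) w"
    and "armijo_condition f \<alpha> z w \<sigma>" and "0 < \<sigma>" "\<sigma> \<le> 1"
    and "\<sigma> = 1 \<or> \<not> armijo_condition f \<alpha> z w (\<sigma> / \<beta>)"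
    and "z' = z - \<sigma> *\<^sub>R w"
proof -
  obtain \<gamma> \<sigma> w where
    \<gamma>: "while_option (\<lambda>\<gamma>'. \<not> direction_condition A\<^sub>1 A\<^sub>2 \<mu> (gradient f z) (dir z v \<gamma>'))
          (\<lambda>\<gamma>'. \<beta> * \<gamma>') \<gamma>\<^sub>0 = Some \<gamma>" and w: "w = dir z v \<gamma>" and
    \<sigma>: "while_option (\<lambda>\<sigma>'. \<not> armijo_condition f \<alpha> z w \<sigma>') (\<lambda>\<sigma>'. \<beta> * \<sigma>') 1 = Some \<sigma>" and
    z': "z' = z - \<sigma> *\<^sub>R w"
    using assms(1) by (auto simp: backtracking_step_def)
  \<comment> \<open>Loop invariant: either no pass has been made, or
    \<open>\<sigma> / \<beta>\<close> is the preceding value, which the guard found to fail.\<close>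
  have "0 < \<sigma> \<and> \<sigma> \<le> 1 \<and> (\<sigma> = 1 \<or> \<not> armijo_condition f \<alpha> z w (\<sigma> / \<beta>))"
    by (rule while_option_rule[OF _ \<sigma>]) (use assms(2,3) in \<open>auto simp: mult_le_one\<close>)
  with while_option_stop[OF \<gamma>] while_option_stop[OF \<sigma>] w z' show ?thesis
    by (intro that) auto
qed

text \<open>The angle condition and the upper bound on \<open>norm w\<close> eliminate the gradient:
  its inner product with \<open>w\<close> is at least a multiple of the square of
  \<open>norm w\<close>. The Armijo condition turns this into a decrease of
  \<open>f\<close>.\<close>

lemma backtracking_step_descent:
  assumes step: "backtracking_step dir f A\<^sub>1 A\<^sub>2 \<gamma>\<^sub>0 \<mu> \<alpha> \<beta> z v z' v'"
    and pars: "0 < A\<^sub>2" "0 < \<mu>" "0 < \<alpha>" "0 < \<beta>" "\<beta> < 1"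
  shows "\<alpha> * \<mu> / A\<^sub>2 * (norm (z' - z))\<^sup>2 \<le> f z - f z'"
proof -
  obtain \<sigma> w where dir: "direction_condition A\<^sub>1 A\<^sub>2 \<mu> (gradient f z) w"
    and armijo: "armijo_condition f \<alpha> z w \<sigma>" and \<sigma>: "0 < \<sigma>" "\<sigma> \<le> 1" and z': "z' = z - \<sigma> *\<^sub>R w"
    using backtracking_stepE[OF step pars(4,5)] by blast
  have "norm w / A\<^sub>2 \<le> norm (gradient f z)"
    using dir \<open>0 < A\<^sub>2\<close> by (simp add: direction_condition_def field_simps)
  then have "\<mu> * (norm w / A\<^sub>2) * norm w \<le> \<mu> * norm (gradient f z) * norm w"
    using \<open>0 < \<mu>\<close> by (intro mult_right_mono mult_left_mono) auto
  also have "\<dots> \<le> gradient f z \<bullet> w"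
    using dir by (simp add: direction_condition_def)
  finally have inner: "\<mu> / A\<^sub>2 * (norm w)\<^sup>2 \<le> gradient f z \<bullet> w"
    by (simp add: power2_eq_square)
  have "\<alpha> * \<mu> / A\<^sub>2 * (norm (z' - z))\<^sup>2 = (\<alpha> * \<sigma>) * (\<mu> / A\<^sub>2 * (norm w)\<^sup>2) * \<sigma>"
    using \<sigma> by (simp add: z' power2_eq_square)
  \<comment> \<open>The squared step carries two factors \<open>\<sigma>\<close>, the Armijo
    decrease only one; \<open>\<sigma> \<le> 1\<close> absorbs the other.\<close>
  also have "\<dots> \<le> (\<alpha> * \<sigma>) * (\<mu> / A\<^sub>2 * (norm w)\<^sup>2)"
    using \<sigma> pars by (intro mult_right_le_one_le) auto
  also have "\<dots> \<le> (\<alpha> * \<sigma>) * (gradient f z \<bullet> w)"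
    using inner \<sigma> pars by (intro mult_left_mono) auto
  also have "\<dots> \<le> f z - f z'"
    using armijo by (simp add: armijo_condition_def z')
  finally show ?thesis .
qed

text \<open>
  If the step size is below 1, the Armijo condition was rejected at \<open>z - (\<sigma> / \<beta>) w\<close>, and \<open>\<xi>\<close> comes
  from the mean value theorem on the segment from \<open>z\<close> to that point.
\<close>

lemma backtracking_step_gradient_bound:
  fixes f :: "'a::euclidean_space \<Rightarrow> real"
  assumes step: "backtracking_step dir f A\<^sub>1 A\<^sub>2 \<gamma>\<^sub>0 \<mu> \<alpha> \<beta> z v z' v'"
    and diff: "\<And>x. f differentiable (at x)"
    and pars: "\<alpha> < 1" "0 < \<beta>" "\<beta> < 1"
  obtains \<xi> where "norm (\<xi> - z) \<le> norm (z' - z) / \<beta>"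
    and "min A\<^sub>1 ((1 - \<alpha>) * \<mu>) * norm (gradient f z) \<le> norm (z' - z) + norm (gradient f z - gradient f \<xi>)"
proof -
  let ?g = "gradient f"
  obtain \<sigma> w where dir: "direction_condition A\<^sub>1 A\<^sub>2 \<mu> (?g z) w"
    and \<sigma>: "0 < \<sigma>" "\<sigma> \<le> 1" "\<sigma> = 1 \<or> \<not> armijo_condition f \<alpha> z w (\<sigma> / \<beta>)"
    and z': "z' = z - \<sigma> *\<^sub>R w"
    using backtracking_stepE[OF step pars(2,3)] by blast
  show ?thesis
  proof (cases "\<sigma> = 1")
    case True
    \<comment> \<open>A full step has length \<open>norm w\<close>, so the lower bound with
      \<open>A\<^sub>1\<close> suffices, and \<xi> can be \<open>z\<close> itself. The minimum
      provides one constant for both cases.\<close>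
    have "min A\<^sub>1 ((1 - \<alpha>) * \<mu>) * norm (?g z) \<le> A\<^sub>1 * norm (?g z)"
      by (intro mult_right_mono) auto
    also have "\<dots> \<le> norm (z' - z)"
      using dir True by (simp add: direction_condition_def z')
    finally show ?thesis
      using \<open>0 < \<beta>\<close> by (intro that[of z]) auto
  next
    case False
    define \<tau> where "\<tau> = \<sigma> / \<beta>"
    have "\<tau> > 0"
      using \<sigma> pars by (simp add: \<tau>_def)
    obtain t where t: "0 \<le> t" "t \<le> 1"
        "f (z + - \<tau> *\<^sub>R w) - f z = (- \<tau> *\<^sub>R w) \<bullet> ?g (z + t *\<^sub>R (- \<tau> *\<^sub>R w))"
      using gradient_mean_value[OF diff] by metis
    define \<xi> where "\<xi> = z + t *\<^sub>R (- \<tau> *\<^sub>R w)"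
    \<comment> \<open>The rejected Armijo inequality, with its left side rewritten by the mean value
      theorem: between \<open>z\<close> and \<xi> the inner product of the gradient with
      \<open>w\<close> falls below the fraction \<alpha> of its value at \<open>z\<close>.\<close>
    have "\<tau> * (w \<bullet> ?g \<xi>) < \<tau> * (\<alpha> * (?g z \<bullet> w))"
      using False \<sigma>(3) t(3) by (simp add: armijo_condition_def \<tau>_def[symmetric] \<xi>_def algebra_simps)
    then have *: "w \<bullet> ?g \<xi> < \<alpha> * (?g z \<bullet> w)"
      using \<open>\<tau> > 0\<close> by simp
    have "((1 - \<alpha>) * \<mu> * norm (?g z)) * norm w = (1 - \<alpha>) * (\<mu> * norm (?g z) * norm w)"
      by simp
    also have "\<dots> \<le> (1 - \<alpha>) * (?g z \<bullet> w)"
      using dir pars by (intro mult_left_mono) (auto simp: direction_condition_def)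
    also have "\<dots> < (?g z - ?g \<xi>) \<bullet> w"
      using * by (simp add: algebra_simps inner_commute)
    also have "\<dots> \<le> norm (?g z - ?g \<xi>) * norm w"
      by (rule norm_cauchy_schwarz)
    \<comment> \<open>Strictness of the chain allows \<open>norm w\<close> to be cancelled without a
      separate proof that it is nonzero.\<close>
    finally have "(1 - \<alpha>) * \<mu> * norm (?g z) \<le> norm (?g z - ?g \<xi>)"
      by (metis mult_right_less_imp_less norm_ge_zero less_imp_le)
    moreover have "min A\<^sub>1 ((1 - \<alpha>) * \<mu>) * norm (?g z) \<le> (1 - \<alpha>) * \<mu> * norm (?g z)"
      by (intro mult_right_mono) auto
    moreover have "norm (\<xi> - z) \<le> norm (z' - z) / \<beta>"
    proof -
      have "norm (\<xi> - z) = t * (\<tau> * norm w)"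
        using t \<open>\<tau> > 0\<close> by (simp add: \<xi>_def)
      also have "\<dots> \<le> \<tau> * norm w"
        using t \<open>\<tau> > 0\<close> by (intro mult_left_le_one_le) auto
      also have "\<dots> = norm (z' - z) / \<beta>"
        using \<sigma> by (simp add: z' \<tau>_def)
      finally show ?thesis .
    qed
    ultimately show ?thesis
      by (intro that[of \<xi>]) (auto intro: order_trans add_increasing)
  qed
qed

section \<open>Passing to the limit: vanishing steps and critical cluster points\<close>

text \<open>The values of \<open>f\<close> decrease along the sequence and are bounded below by
  \<open>f l\<close>, so they converge. Their successive differences tend to 0 and dominate the
  squared steps.\<close>

lemma steps_tendsto_0_if_cluster_point:
  fixes z :: "nat \<Rightarrow> 'a::real_normed_vector"
  assumes "c > 0" and descent: "\<And>n. c * (norm (z (Suc n) - z n))\<^sup>2 \<le> f (z n) - f (z (Suc n))"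
    and "continuous_on UNIV f" and "l \<in> cluster_points z"
  shows "(\<lambda>n. norm (z (Suc n) - z n)) \<longlonglongrightarrow> 0"
proof -
  obtain r where r: "strict_mono r" "(z \<circ> r) \<longlonglongrightarrow> l"
    using assms(4) by (auto simp: cluster_points_def)
  have fz: "(\<lambda>k. f (z (r k))) \<longlonglongrightarrow> f l"
    using continuous_on_tendsto_compose[OF assms(3) r(2)] by (simp add: o_def)
  have "f (z (Suc n)) \<le> f (z n)" for n
  proof -
    have "0 \<le> c * (norm (z (Suc n) - z n))\<^sup>2"
      using \<open>c > 0\<close> by simp
    with descent[of n] show ?thesis by linarith
  qed
  then have dec: "decseq (\<lambda>n. f (z n))"
    by (rule decseq_SucI)
  have "f l \<le> f (z n)" for n
  proof (rule LIMSEQ_le_const2[OF fz], intro exI allI impI)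
    fix k assume "k \<ge> n"
    then have "n \<le> r k"
      using seq_suble[OF r(1), of k] by linarith
    with dec show "f (z (r k)) \<le> f (z n)"
      by (auto simp: decseq_def)
  qed
  then obtain L where L: "(\<lambda>n. f (z n)) \<longlonglongrightarrow> L"
    using decseq_convergent[OF dec] by blast
  have "(\<lambda>n. (f (z n) - f (z (Suc n))) / c) \<longlonglongrightarrow> (L - L) / c"
    by (intro tendsto_intros L LIMSEQ_Suc) (use \<open>c > 0\<close> in auto)
  then have lim0: "(\<lambda>n. (f (z n) - f (z (Suc n))) / c) \<longlonglongrightarrow> 0"
    by simp
  have "(\<lambda>n. (norm (z (Suc n) - z n))\<^sup>2) \<longlonglongrightarrow> 0"
    by (rule tendsto_sandwich[OF _ _ tendsto_const lim0])
      (use descent \<open>c > 0\<close> in \<open>auto simp: field_simps\<close>)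
  from tendsto_real_sqrt[OF this] show ?thesis
    by simp
qed

text \<open>Along a subsequence of \<open>z\<close> tending to \<open>l\<close>, the points \<xi>
  tend to \<open>l\<close> too. By continuity both gradients tend to the one at \<open>l\<close>, so
  the right-hand side of \<open>bound\<close> tends to 0.\<close>

lemma cluster_points_subset_critical_points:
  fixes z :: "nat \<Rightarrow> 'a::real_inner"
  assumes steps: "(\<lambda>n. norm (z (Suc n) - z n)) \<longlonglongrightarrow> 0"
    and "\<kappa> > 0" and cont: "continuous_on UNIV (gradient f)"
    and \<xi>: "\<And>n. norm (\<xi> n - z n) \<le> norm (z (Suc n) - z n) / \<beta>"
    and bound: "\<And>n. \<kappa> * norm (gradient f (z n)) \<le>
        norm (z (Suc n) - z n) + norm (gradient f (z n) - gradient f (\<xi> n))"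
  shows "cluster_points z \<subseteq> critical_points f"
proof
  fix l
  assume "l \<in> cluster_points z"
  then obtain r where r: "strict_mono r" "(\<lambda>k. z (r k)) \<longlonglongrightarrow> l"
    by (auto simp: cluster_points_def o_def)
  have steps_r: "(\<lambda>k. norm (z (Suc (r k)) - z (r k))) \<longlonglongrightarrow> 0"
    using LIMSEQ_subseq_LIMSEQ[OF steps r(1)] by (simp add: o_def)
  have "(\<lambda>k. norm (z (Suc (r k)) - z (r k)) / \<beta>) \<longlonglongrightarrow> 0"
    using tendsto_divide_zero[OF steps_r] .
  then have "(\<lambda>k. \<xi> (r k) - z (r k)) \<longlonglongrightarrow> 0"
    by (rule Lim_null_comparison[rotated]) (use \<xi> in auto)
  from tendsto_add[OF this r(2)] have "(\<lambda>k. \<xi> (r k)) \<longlonglongrightarrow> l"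
    by simp
  then have g\<xi>: "(\<lambda>k. gradient f (\<xi> (r k))) \<longlonglongrightarrow> gradient f l"
    using continuous_on_tendsto_compose[OF cont] by simp
  have gz: "(\<lambda>k. gradient f (z (r k))) \<longlonglongrightarrow> gradient f l"
    using continuous_on_tendsto_compose[OF cont r(2)] by simp
  have "\<kappa> * norm (gradient f l) \<le> 0 + norm (gradient f l - gradient f l)"
  proof (rule tendsto_le[OF sequentially_bot])
    show "(\<lambda>k. \<kappa> * norm (gradient f (z (r k)))) \<longlonglongrightarrow> \<kappa> * norm (gradient f l)"
      by (intro tendsto_intros gz)
    show "(\<lambda>k. norm (z (Suc (r k)) - z (r k)) + norm (gradient f (z (r k)) - gradient f (\<xi> (r k))))
        \<longlonglongrightarrow> 0 + norm (gradient f l - gradient f l)"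
      by (intro tendsto_intros steps_r gz g\<xi>)
  qed (simp add: bound)
  with \<open>\<kappa> > 0\<close> show "l \<in> critical_points f"
    by (simp add: critical_points_def mult_le_0_iff)
qed

theorem theorem2p11:
  fixes f :: "real ^ 'm \<Rightarrow> real"
    and A\<^sub>1 A\<^sub>2 \<delta>\<^sub>0 \<gamma>\<^sub>0 \<mu> \<alpha> \<beta> :: real
    and z_init v_init :: "real ^ 'm"
    and z :: "nat \<Rightarrow> real ^ 'm"
  assumes "0 < A\<^sub>1" and "A\<^sub>1 < 1" and "1 < A\<^sub>2"
    and "\<delta>\<^sub>0 > 0" and "\<gamma>\<^sub>0 > 0"
    and "0 < \<mu>" and "\<mu> \<le> 1"
    and "0 < \<alpha>" and "\<alpha> < 1" and "0 < \<beta>" and "\<beta> < 1"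
    and "C1_function f"
    and "backtracking_MMT f A\<^sub>1 A\<^sub>2 \<delta>\<^sub>0 \<gamma>\<^sub>0 \<mu> \<alpha> \<beta> z_init v_init z \<or>
         backtracking_NAG f A\<^sub>1 A\<^sub>2 \<delta>\<^sub>0 \<gamma>\<^sub>0 \<mu> \<alpha> \<beta> z_init v_init z"
  shows "(filterlim (\<lambda>n. norm (z n)) at_top sequentially \<or>
            (\<lambda>n. norm (z (Suc n) - z n)) \<longlonglongrightarrow> 0) \<and>
         (countable (critical_points f) \<longrightarrow>
            filterlim (\<lambda>n. norm (z n)) at_top sequentially \<or>
            (\<exists>x \<in> critical_points f. z \<longlonglongrightarrow> x)) \<and>
         ((\<forall>C \<in> components (critical_points f). compact C) \<longrightarrow>
            (filterlim (\<lambda>n. norm (z n)) at_top sequentially \<or> bounded (range z)) \<and>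
            (bounded (range z) \<longrightarrow> connected (cluster_points z)))"
proof (cases "filterlim (\<lambda>n. norm (z n)) at_top sequentially")
  case True
  \<comment> \<open>Divergence settles every alternative; the connectedness claim is conditional on
    boundedness and becomes vacuous.\<close>
  have "\<not> bounded (range z)"
  proof
    assume "bounded (range z)"
    then obtain B where "\<And>n. norm (z n) \<le> B"
      by (auto simp: bounded_iff)
    moreover obtain n where "norm (z n) > B"
      using True by (auto simp: filterlim_at_top_dense eventually_sequentially)
    ultimately show False
      by (meson not_le)
  qed
  with True show ?thesis by blast
next
  case False
  let ?K = "critical_points f"
  have diff: "\<And>x. f differentiable (at x)" and cont: "continuous_on UNIV (gradient f)"
    using \<open>C1_function f\<close> by (auto simp: C1_function_def)
  obtain dir v where step:
    "\<And>n. backtracking_step dir f A\<^sub>1 A\<^sub>2 \<gamma>\<^sub>0 \<mu> \<alpha> \<beta> (z n) (v n) (z (Suc n)) (v (Suc n))"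
    using assms(13) unfolding backtracking_MMT_def backtracking_NAG_def backtracking_sequence_def
    by metis
  obtain l where l: "l \<in> cluster_points z"
    using cluster_point_if_not_norm_at_top[OF False] .
  have steps: "(\<lambda>n. norm (z (Suc n) - z n)) \<longlonglongrightarrow> 0"
  proof (rule steps_tendsto_0_if_cluster_point[OF _ _ _ l])
    show "\<alpha> * \<mu> / A\<^sub>2 * (norm (z (Suc n) - z n))\<^sup>2 \<le> f (z n) - f (z (Suc n))" for n
      using backtracking_step_descent[OF step] assms by simp
    show "continuous_on UNIV f"
      using diff by (simp add: continuous_at_imp_continuous_on differentiable_imp_continuous_within)
  qed (use assms in auto)
  have "\<exists>\<xi>. norm (\<xi> - z n) \<le> norm (z (Suc n) - z n) / \<beta> \<and>
      min A\<^sub>1 ((1 - \<alpha>) * \<mu>) * norm (gradient f (z n)) \<le>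
        norm (z (Suc n) - z n) + norm (gradient f (z n) - gradient f \<xi>)" for n
    using backtracking_step_gradient_bound[OF step diff] assms(9-11) by metis
  then obtain \<xi> where \<xi>: "\<And>n. norm (\<xi> n - z n) \<le> norm (z (Suc n) - z n) / \<beta>"
      "\<And>n. min A\<^sub>1 ((1 - \<alpha>) * \<mu>) * norm (gradient f (z n)) \<le>
        norm (z (Suc n) - z n) + norm (gradient f (z n) - gradient f (\<xi> n))"
    by metis
  have sub: "cluster_points z \<subseteq> ?K"
    by (rule cluster_points_subset_critical_points[OF steps _ cont \<xi>]) (use assms in auto)
  have "closed ?K"
    unfolding critical_points_def using cont by (intro closed_Collect_eq) auto
  then have bdd: "bounded (range z)" if "\<forall>C \<in> components ?K. compact C"
    using bounded_if_cluster_points_in_compact_components[OF steps _ _ sub] that l by blast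
  have conn: "bounded (range z) \<Longrightarrow> connected (cluster_points z)"
    using connected_cluster_points[OF steps] .
  have "z \<longlonglongrightarrow> l" if "countable ?K"
  proof (rule tendsto_unique_cluster_point)
    \<comment> \<open>A connected set with two distinct points is uncountable, so the components are
      singletons, hence compact, and the boundedness result for compact components applies.\<close>
    have "C \<subseteq> {c}" if "C \<in> components ?K" "c \<in> C" for C c
      using that \<open>countable ?K\<close> connected_uncountable[of C c]
      by (metis countable_subset in_components_connected in_components_subset insert_iff subsetI)
    then have "compact C" if "C \<in> components ?K" for C
      using that finite_subset finite_imp_compact in_components_nonempty
      by (metis equals0I finite.emptyI finite_insert)
    then show "bounded (range z)"
      using bdd by blast
    \<comment> \<open>The same cardinality argument applies to the connected cluster set, which is
      countable as a subset of the critical set.\<close>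
    with conn show "cluster_points z \<subseteq> {l}"
      using l sub that connected_uncountable countable_subset by blast
  qed
  then show ?thesis
    using steps bdd conn sub l by blast
qed

end
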